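(* Let $(\Omega,\mathcal{A},\mathbb{P})$ be a probability space and let $(E_n)_{n\in\mathbb{N}}$ be an independent family of events such that $C_1:=\sum_{n=1}^\infty\mathbb{P}(E_n)<1$. Let $\mathcal{O}:=\sum_{n=1}^\infty\mathbf{1}_{E_n}$. Then $$\mathbb{E}\big[e^{r\mathcal{O}}\big]\leqslant \big(1-C_1e^{r}\big)^{-1}\qquad\text{for all } r<|\ln(C_1)|.$$
   Context: $\mathbb{N}=\{1,2,\dots\}$. Convention: $|\ln(0)|:=+\infty$. *)

theory Defs
  imports "HOL-Probability.Probability"
begin

(* The events are indexed by n = 1, 2, ...; the Suc shift skips the value at 0. The count is
   infinite at points lying in infinitely many of the events. *)
definition occurrences :: "(nat \<Rightarrow> 'a set) \<Rightarrow> 'a \<Rightarrow> ereal" where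
  "occurrences E \<omega> = (\<Sum>n. indicator (E (Suc n)) \<omega>)"

definition exp_ext :: "ereal \<Rightarrow> ennreal" where
  "exp_ext x = (case x of ereal t \<Rightarrow> ennreal (exp t) | PInfty \<Rightarrow> \<infinity> | MInfty \<Rightarrow> 0)"

lemma exp_ext_simps [simp]:
  "exp_ext (ereal t) = ennreal (exp t)"
  "exp_ext \<infinity> = \<infinity>"
  "exp_ext (-\<infinity>) = 0"
  by (simp_all add: exp_ext_def flip: MInfty_eq_minfinity)

(* Needed because ln 0 = 0 in the library. *)
definition abs_ln :: "real \<Rightarrow> ereal" where
  "abs_ln x = (if x = 0 then \<infinity> else ereal \<bar>ln x\<bar>)"

end

theory Submission
  imports Defs
begin

text \<open>
  By independence, the moment generating function of the number of events among
  \<open>E\<^sub>1, \<dots>, E\<^sub>N\<close> that occur is the product of the factors \<open>1 + p\<^sub>n (e\<^sup>r - 1)\<close>, where \<open>p\<^sub>n\<close> is the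
  probability of \<open>E\<^sub>n\<close>. As \<open>1 + x \<le> e\<^sup>x\<close>, the product is at most
  \<open>exp ((p\<^sub>1 + \<dots> + p\<^sub>N) (e\<^sup>r - 1))\<close>, and Fatou's lemma gives the Poisson bound
  \<open>exp (C\<^sub>1 (e\<^sup>r - 1))\<close> for the whole sequence (\<open>nn_integral_exp_occurrences_le\<close>). This
  holds for every real \<open>r\<close>. The condition on \<open>r\<close> says that \<open>C\<^sub>1 e\<^sup>r < 1\<close>; then
  \<open>exp (C\<^sub>1 (e\<^sup>r - 1)) \<le> exp (C\<^sub>1 e\<^sup>r) \<le> 1 / (1 - C\<^sub>1 e\<^sup>r)\<close>, the last step being the same
  inequality at \<open>- C\<^sub>1 e\<^sup>r\<close>.
\<close>

context prob_space
begin

text \<open>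
  A single event generates a sigma algebra of four sets, and passing to generated sigma algebras
  preserves independence; hence the truth values of independent events are independent random
  variables, and so is everything computed from them.
\<close>

lemma indep_vars_mem_of_indep_events:
  assumes "indep_events A I"
  shows "indep_vars (\<lambda>_. count_space UNIV) (\<lambda>i \<omega>. \<omega> \<in> A i) I"
  unfolding indep_vars_def2
proof (intro conjI ballI)
  fix i assume "i \<in> I"
  then have [measurable]: "A i \<in> events"
    using assms by (auto simp: indep_events_def)
  show "random_variable (count_space UNIV) (\<lambda>\<omega>. \<omega> \<in> A i)"
    by measurable
next
  have sub: "A i \<subseteq> space M" if "i \<in> I" for i
    using assms that sets.sets_into_space by (auto simp: indep_events_def)
  have "indep_sets (\<lambda>i. sigma_sets (space M) {A i}) I"
    using assms by (intro indep_sets_sigma) (auto simp: indep_events_def_alt Int_stable_def)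
  then show "indep_sets
      (\<lambda>i. {(\<lambda>\<omega>. \<omega> \<in> A i) -` B \<inter> space M |B. B \<in> sets (count_space UNIV)}) I"
  proof (rule indep_sets_mono_sets)
    fix i assume i: "i \<in> I"
    have "(\<lambda>\<omega>. \<omega> \<in> A i) -` B \<inter> space M
        = (if True \<in> B then A i else {}) \<union> (if False \<in> B then space M - A i else {})" for B
    proof (rule set_eqI)
      fix \<omega>
      show "\<omega> \<in> (\<lambda>\<omega>. \<omega> \<in> A i) -` B \<inter> space M
          \<longleftrightarrow> \<omega> \<in> (if True \<in> B then A i else {}) \<union> (if False \<in> B then space M - A i else {})"
        using sub[OF i] by (cases "\<omega> \<in> A i") auto
    qed
    then have "(\<lambda>\<omega>. \<omega> \<in> A i) -` B \<inter> space M \<in> {{}, A i, space M - A i, space M}" for B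
      using sub[OF i] by auto
    then show "{(\<lambda>\<omega>. \<omega> \<in> A i) -` B \<inter> space M |B. B \<in> sets (count_space UNIV)}
        \<subseteq> sigma_sets (space M) {A i}"
      using sub[OF i] by (subst sigma_sets_singleton) auto
  qed
qed

lemma nn_integral_exp_indicator:
  assumes [measurable]: "A \<in> events"
  shows "(\<integral>\<^sup>+\<omega>. ennreal (exp (r * indicator A \<omega>)) \<partial>M) = ennreal (1 + prob A * (exp r - 1))"
proof -
  have "(\<integral>\<^sup>+\<omega>. ennreal (exp (r * indicator A \<omega>)) \<partial>M)
      = (\<integral>\<^sup>+\<omega>. ennreal (exp r) * indicator A \<omega> + indicator (space M - A) \<omega> \<partial>M)"
    by (intro nn_integral_cong) (auto simp: indicator_def)
  also have "\<dots> = ennreal (exp r) * emeasure M A + emeasure M (space M - A)"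
    by (simp add: nn_integral_add nn_integral_cmult)
  also have "\<dots> = ennreal (exp r * prob A + (1 - prob A))"
    by (simp add: emeasure_eq_measure prob_compl ennreal_mult' ennreal_plus)
  also have "exp r * prob A + (1 - prob A) = 1 + prob A * (exp r - 1)"
    by (simp add: algebra_simps)
  finally show ?thesis .
qed

text \<open>
  Independence turns the integral into a product, and \<open>1 + x \<le> exp x\<close> turns the product into
  a bound that depends on the sum of the probabilities only.
\<close>

lemma nn_integral_exp_count_le:
  assumes indep: "indep_events A I" and fin: "finite I"
  shows "(\<integral>\<^sup>+\<omega>. ennreal (exp (r * (\<Sum>i\<in>I. indicator (A i) \<omega>))) \<partial>M)
    \<le> ennreal (exp ((\<Sum>i\<in>I. prob (A i)) * (exp r - 1)))"
proof -
  have ev: "A i \<in> events" if "i \<in> I" for i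
    using indep that by (auto simp: indep_events_def)
  have "indep_vars (\<lambda>_. borel) (\<lambda>i \<omega>. ennreal (exp (r * of_bool (\<omega> \<in> A i)))) I"
    by (rule indep_vars_compose2[OF indep_vars_mem_of_indep_events[OF indep],
          where Y = "\<lambda>_ b. ennreal (exp (r * of_bool b))"]) simp
  then have iv: "indep_vars (\<lambda>_. borel) (\<lambda>i \<omega>. ennreal (exp (r * indicator (A i) \<omega>))) I"
    by (simp add: indicator_def)
  have "(\<integral>\<^sup>+\<omega>. ennreal (exp (r * (\<Sum>i\<in>I. indicator (A i) \<omega>))) \<partial>M)
      = (\<integral>\<^sup>+\<omega>. (\<Prod>i\<in>I. ennreal (exp (r * indicator (A i) \<omega>))) \<partial>M)"
    by (simp only: sum_distrib_left exp_sum[OF fin] prod_ennreal exp_ge_zero)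
  also have "\<dots> = (\<Prod>i\<in>I. \<integral>\<^sup>+\<omega>. ennreal (exp (r * indicator (A i) \<omega>)) \<partial>M)"
    using fin iv by (intro indep_vars_nn_integral) auto
  also have "\<dots> = (\<Prod>i\<in>I. ennreal (1 + prob (A i) * (exp r - 1)))"
    using ev by (intro prod.cong refl nn_integral_exp_indicator)
  also have "\<dots> \<le> (\<Prod>i\<in>I. ennreal (exp (prob (A i) * (exp r - 1))))"
    by (intro prod_mono_ennreal ennreal_leI exp_ge_add_one_self)
  also have "\<dots> = ennreal (exp ((\<Sum>i\<in>I. prob (A i)) * (exp r - 1)))"
    by (simp add: sum_distrib_right exp_sum fin prod_ennreal)
  finally show ?thesis .
qed

end

text \<open>
  The extended exponential takes its limiting values at infinity, so the integrands of the
  partial counts converge even at points lying in infinitely many events. At \<open>r = 0\<close> and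
  an infinite count this relies on \<open>0 * \<infinity> = 0\<close>.
\<close>

lemma exp_partial_occurrences_tendsto:
  "(\<lambda>N. ennreal (exp (r * (\<Sum>i=1..N. indicator (E i) \<omega>))))
    \<longlonglongrightarrow> exp_ext (ereal r * occurrences E \<omega>)"
proof -
  define S :: "nat \<Rightarrow> real" where "S N = (\<Sum>i=1..N. indicator (E i) \<omega>)" for N
  have "(\<lambda>N. \<Sum>n<N. indicator (E (Suc n)) \<omega> :: ereal) \<longlonglongrightarrow> occurrences E \<omega>"
    unfolding occurrences_def by (intro summable_LIMSEQ summable_ereal_pos) simp
  moreover have "(\<Sum>n<N. indicator (E (Suc n)) \<omega> :: ereal) = ereal (S N)" for N
  proof -
    have "(\<Sum>n<N. indicator (E (Suc n)) \<omega> :: ereal)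
        = ereal (\<Sum>n<N. indicator (E (Suc n)) \<omega>)"
      unfolding sum_ereal[symmetric] by (intro sum.cong) (auto simp: indicator_def)
    also have "(\<Sum>n<N. indicator (E (Suc n)) \<omega>) = S N"
      unfolding S_def
      by (simp add: sum.atLeast1_atMost_eq)
    finally show ?thesis .
  qed
  ultimately have lim: "(\<lambda>N. ereal (S N)) \<longlonglongrightarrow> occurrences E \<omega>"
    by simp
  have "(\<lambda>N. ennreal (exp (r * S N))) \<longlonglongrightarrow> exp_ext (ereal r * occurrences E \<omega>)"
  proof (cases "occurrences E \<omega>")
    case (real t)
    with lim have "S \<longlonglongrightarrow> t"
      by simp
    then show ?thesis
      unfolding real by (auto intro!: tendsto_ennrealI tendsto_intros)
  next
    case PInf
    with lim have S: "filterlim S at_top sequentially"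
      by (simp add: tendsto_PInfty_eq_at_top)
    consider "r = 0" | "r > 0" | "r < 0"
      by linarith
    then show ?thesis
    proof cases
      case 1
      then show ?thesis
        by (simp add: zero_ereal_def[symmetric] exp_ext_simps(1)[of 0, folded zero_ereal_def])
    next
      case 2
      have "filterlim (\<lambda>N. exp (r * S N)) at_top sequentially"
        by (intro filterlim_compose[OF exp_at_top]
            filterlim_tendsto_pos_mult_at_top[OF tendsto_const 2 S])
      then show ?thesis
        using 2 PInf by (simp add: ennreal_tendsto_top_eq_at_top infinity_ennreal_def)
    next
      case 3
      have "(\<lambda>N. exp (r * S N)) \<longlonglongrightarrow> 0"
        by (intro filterlim_compose[OF exp_at_bot]
            filterlim_tendsto_neg_mult_at_bot[OF tendsto_const 3 S])
      then show ?thesis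
        using 3 PInf by (simp flip: ennreal_0 add: tendsto_ennrealI)
    qed
  next
    case MInf
    have "0 \<le> occurrences E \<omega>"
      unfolding occurrences_def by (intro suminf_0_le summable_ereal_pos) simp_all
    with MInf show ?thesis
      by simp
  qed
  then show ?thesis
    unfolding S_def .
qed

text \<open>
  The bound is the moment generating function of a Poisson variable with mean \<open>C\<close>. Fatou's
  lemma carries it from finitely many events to the limit whatever the sign of \<open>r\<close>, whereas
  monotone convergence would cover \<open>r \<ge> 0\<close> only.
\<close>

lemma (in prob_space) nn_integral_exp_occurrences_le:
  assumes indep: "indep_events E {1..}" and sums: "(\<lambda>n. prob (E (Suc n))) sums C"
  shows "(\<integral>\<^sup>+\<omega>. exp_ext (ereal r * occurrences E \<omega>) \<partial>M) \<le> ennreal (exp (C * (exp r - 1)))"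
proof -
  have [measurable]: "E i \<in> events" if "i \<ge> 1" for i
    using indep that by (auto simp: indep_events_def)
  define f where "f N \<omega> = ennreal (exp (r * (\<Sum>i=1..N. indicator (E i) \<omega>)))" for N \<omega>
  have f_meas: "f N \<in> borel_measurable M" for N
    unfolding f_def by measurable
  have "(\<integral>\<^sup>+\<omega>. exp_ext (ereal r * occurrences E \<omega>) \<partial>M) = (\<integral>\<^sup>+\<omega>. liminf (\<lambda>N. f N \<omega>) \<partial>M)"
    unfolding f_def
    by (intro nn_integral_cong lim_imp_Liminf[symmetric] exp_partial_occurrences_tendsto) simp
  also have "\<dots> \<le> liminf (\<lambda>N. \<integral>\<^sup>+\<omega>. f N \<omega> \<partial>M)"
    by (intro nn_integral_liminf f_meas)
  also have "\<dots> \<le> liminf (\<lambda>N. ennreal (exp ((\<Sum>i=1..N. prob (E i)) * (exp r - 1))))"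
  proof (intro Liminf_mono always_eventually allI)
    fix N
    have "indep_events E {1..N}"
      using indep unfolding indep_events_def_alt by (rule indep_sets_mono_index[rotated]) auto
    then show "(\<integral>\<^sup>+\<omega>. f N \<omega> \<partial>M) \<le> ennreal (exp ((\<Sum>i=1..N. prob (E i)) * (exp r - 1)))"
      unfolding f_def by (rule nn_integral_exp_count_le) simp
  qed
  also have "\<dots> = ennreal (exp (C * (exp r - 1)))"
  proof (intro lim_imp_Liminf tendsto_ennrealI tendsto_intros)
    show "(\<lambda>N. \<Sum>i=1..N. prob (E i)) \<longlonglongrightarrow> C"
      using sums by (simp add: sums_def sum.atLeast1_atMost_eq)
  qed simp
  finally show ?thesis .
qed

text \<open>
  The assumption \<open>C < 1\<close> makes \<open>\<bar>ln C\<bar>\<close> equal to \<open>- ln C\<close>, which is where \<open>C e\<^sup>r\<close> reaches 1.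
\<close>

lemma mult_exp_less_1_of_less_abs_ln:
  assumes "0 \<le> C" "C < 1" "ereal r < abs_ln C"
  shows "C * exp r < 1"
proof (cases "C = 0")
  case False
  with assms have "C > 0" and "ln C < 0"
    by auto
  with assms have "r + ln C < 0"
    by (simp add: abs_ln_def)
  then have "exp (r + ln C) < 1"
    by simp
  with \<open>C > 0\<close> show ?thesis
    by (simp add: exp_add mult.commute)
qed simp

lemma exp_le_inverse_one_minus:
  fixes x :: real
  assumes "x < 1"
  shows "exp x \<le> inverse (1 - x)"
  using le_imp_inverse_le[of "1 - x" "exp (- x)"] exp_ge_add_one_self[of "- x"] assms
  by (simp add: exp_minus)

theorem theorem3:
  fixes M :: "'a measure" and E :: "nat \<Rightarrow> 'a set" and C\<^sub>1 r :: real
  assumes "prob_space M"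
    and "prob_space.indep_events M E {1..}"
    and "(\<lambda>n. measure M (E (Suc n))) sums C\<^sub>1"
    and "C\<^sub>1 < 1"
    and "ereal r < abs_ln C\<^sub>1"
  shows "(\<integral>\<^sup>+\<omega>. exp_ext (ereal r * occurrences E \<omega>) \<partial>M) \<le> ennreal (inverse (1 - C\<^sub>1 * exp r))"
proof -
  interpret prob_space M
    by fact
  have "0 \<le> C\<^sub>1"
    using sums_le[OF _ sums_zero assms(3)] by simp
  have "(\<integral>\<^sup>+\<omega>. exp_ext (ereal r * occurrences E \<omega>) \<partial>M) \<le> ennreal (exp (C\<^sub>1 * (exp r - 1)))"
    using assms(2,3) by (rule nn_integral_exp_occurrences_le)
  also have "\<dots> \<le> ennreal (exp (C\<^sub>1 * exp r))"
    using \<open>0 \<le> C\<^sub>1\<close> by (intro ennreal_leI) (simp add: algebra_simps)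
  also have "\<dots> \<le> ennreal (inverse (1 - C\<^sub>1 * exp r))"
    using mult_exp_less_1_of_less_abs_ln[OF \<open>0 \<le> C\<^sub>1\<close> assms(4,5)]
    by (intro ennreal_leI exp_le_inverse_one_minus)
  finally show ?thesis .
qed

end
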